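(* Let $\{C_2,C_1,R,\partial_2,\partial_1\}$, i.e. $C_2\xrightarrow{\partial_2}C_1\xrightarrow{\partial_1}R$, be a $2$-crossed module and let $\phi:S\to R$ be a monomorphism of $k$-algebras. Put $\phi^*(C_1)=C_1\times_R S=\{(c_1,s)\in C_1\times S\mid \partial_1(c_1)=\phi(s)\}$. Then $$C_2\xrightarrow{\ \partial_2^*\ }\phi^*(C_1)\xrightarrow{\ \partial_1^*\ }S,\qquad \partial_2^*(c_2)=(\partial_2(c_2),0),\quad \partial_1^*(c_1,s)=s,$$ where $S$ acts on $\phi^*(C_1)$ by $s\cdot(c_1,s')=(\phi(s)\cdot c_1,ss')$ and on $C_2$ by $s\cdot c_2=\phi(s)\cdot c_2$, and where the Peiffer lifting is $\{(c_1,s),(c_1',s')\}=\{c_1,c_1'\}$, is a pullback $2$-crossed module of $\{C_2,C_1,R,\partial_2,\partial_1\}$ along $\phi$.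
   Context: Conventions. $k$ is a fixed commutative ring with identity. All algebras are commutative associative $k$-algebras. Base algebras (the last term of a $2$-crossed module, e.g. $P,R,S$) have an identity, and homomorphisms between base algebras preserve it; other algebras need not have an identity. An action of $P$ on an algebra $M$ is a $k$-bilinear map $P\times M\to M$, $(p,m)\mapsto p\cdot m=m\cdot p$, with $p\cdot(mm')=(p\cdot m)m'$, $(pp')\cdot m=p\cdot(p'\cdot m)$, $1\cdot m=m$. A $2$-crossed module $\{L,M,P,\partial_2,\partial_1\}$ consists of a complex of $P$-algebras $L\xrightarrow{\partial_2}M\xrightarrow{\partial_1}P$ (so $\partial_1\partial_2=0$), with an action of $P$ on all three algebras (on itself by multiplication) for which $\partial_2,\partial_1$ are $P$-equivariant algebra morphisms, together with a $P$-bilinear map $\{-,-\}:M\times M\to L$ (the Peiffer lifting) such that for all $m,m_0,m_1,m_2\in M$, $l,l_0,l_1\in L$, $p\in P$: PL1: $\partial_2\{m_0,m_1\}=m_0m_1-\partial_1(m_1)\cdot m_0$; PL2: $\{\partial_2(l_0),\partial_2(l_1)\}=l_0l_1$; PL3: $\{m_0,m_1m_2\}=\{m_0m_1,m_2\}+\partial_1(m_2)\cdot\{m_0,m_1\}$; PL4: $\{m,\partial_2(l)\}-\{\partial_2(l),m\}=\partial_1(m)\cdot l$; PL5: $\{m_0,m_1\}\cdot p=\{m_0\cdot p,m_1\}=\{m_0,m_1\cdot p\}$. A morphism $(f_2,f_1,f_0):\{L,M,P,\partial_2,\partial_1\}\to\{L',M',P',\partial_2',\partial_1'\}$ consists of algebra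 morphisms $f_2:L\to L'$, $f_1:M\to M'$, $f_0:P\to P'$ with $f_0\partial_1=\partial_1'f_1$, $f_1\partial_2=\partial_2'f_2$, $f_1(p\cdot m)=f_0(p)\cdot f_1(m)$, $f_2(p\cdot l)=f_0(p)\cdot f_2(l)$, and $\{f_1(m),f_1(m')\}=f_2\{m,m'\}$. Pullback $2$-crossed module: given $\{C_2,C_1,R,\partial_2,\partial_1\}$ and $\phi:S\to R$, a $2$-crossed module $\{C_2,\phi^*(C_1),S,\partial_2^*,\partial_1^*\}$ is a pullback along $\phi$ if $(\mathrm{id}_{C_2},\phi',\phi):\{C_2,\phi^*(C_1),S,\partial_2^*,\partial_1^*\}\to\{C_2,C_1,R,\partial_2,\partial_1\}$, with $\phi'(c_1,s)=c_1$, is a morphism of $2$-crossed modules, and for every morphism of $2$-crossed modules $(f_2,f_1,\phi):\{B_2,B_1,S,\partial_2',\partial_1'\}\to\{C_2,C_1,R,\partial_2,\partial_1\}$ there is a unique morphism $(f_2^*,f_1^*,\mathrm{id}_S):\{B_2,B_1,S,\partial_2',\partial_1'\}\to\{C_2,\phi^*(C_1),S,\partial_2^*,\partial_1^*\}$ with $(\mathrm{id}_{C_2},\phi',\phi)\circ(f_2^*,f_1^*,\mathrm{id}_S)=(f_2,f_1,\phi)$. *)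

theory Defs
  imports "HOL-Algebra.Module"
begin

text \<open>
  Commutative associative algebras over a commutative ring \<open>k\<close> are records of type
  \<^typ>\<open>('k, 'a) module\<close>. Algebras with an identity are instances of \<^locale>\<open>algebra\<close>; algebras that
  need not have one are instances of the following locale, which puts no constraint on
  the record field \<^const>\<open>one\<close> (so that field is irrelevant for them).
\<close>

locale nonunital_algebra = module +
  assumes mult_closed:
      "\<lbrakk>x \<in> carrier M; y \<in> carrier M\<rbrakk> \<Longrightarrow> x \<otimes>\<^bsub>M\<^esub> y \<in> carrier M"
    and mult_assoc:
      "\<lbrakk>x \<in> carrier M; y \<in> carrier M; z \<in> carrier M\<rbrakk> \<Longrightarrow>
        (x \<otimes>\<^bsub>M\<^esub> y) \<otimes>\<^bsub>M\<^esub> z = x \<otimes>\<^bsub>M\<^esub> (y \<otimes>\<^bsub>M\<^esub> z)"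
    and mult_comm:
      "\<lbrakk>x \<in> carrier M; y \<in> carrier M\<rbrakk> \<Longrightarrow> x \<otimes>\<^bsub>M\<^esub> y = y \<otimes>\<^bsub>M\<^esub> x"
    and distr:
      "\<lbrakk>x \<in> carrier M; y \<in> carrier M; z \<in> carrier M\<rbrakk> \<Longrightarrow>
        (x \<oplus>\<^bsub>M\<^esub> y) \<otimes>\<^bsub>M\<^esub> z = x \<otimes>\<^bsub>M\<^esub> z \<oplus>\<^bsub>M\<^esub> y \<otimes>\<^bsub>M\<^esub> z"
    and smult_mult:
      "\<lbrakk>a \<in> carrier R; x \<in> carrier M; y \<in> carrier M\<rbrakk> \<Longrightarrow>
        (a \<odot>\<^bsub>M\<^esub> x) \<otimes>\<^bsub>M\<^esub> y = a \<odot>\<^bsub>M\<^esub> (x \<otimes>\<^bsub>M\<^esub> y)"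

definition algebra_hom ::
    "('k, 'r) ring_scheme \<Rightarrow> ('k, 'a) module \<Rightarrow> ('k, 'b) module \<Rightarrow> ('a \<Rightarrow> 'b) set" where
  "algebra_hom k A B =
     {f. f \<in> carrier A \<rightarrow> carrier B \<and>
         (\<forall>x\<in>carrier A. \<forall>y\<in>carrier A. f (x \<oplus>\<^bsub>A\<^esub> y) = f x \<oplus>\<^bsub>B\<^esub> f y) \<and>
         (\<forall>x\<in>carrier A. \<forall>y\<in>carrier A. f (x \<otimes>\<^bsub>A\<^esub> y) = f x \<otimes>\<^bsub>B\<^esub> f y) \<and>
         (\<forall>a\<in>carrier k. \<forall>x\<in>carrier A. f (a \<odot>\<^bsub>A\<^esub> x) = a \<odot>\<^bsub>B\<^esub> f x)}"

definition unital_algebra_hom ::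
    "('k, 'r) ring_scheme \<Rightarrow> ('k, 'a) module \<Rightarrow> ('k, 'b) module \<Rightarrow> ('a \<Rightarrow> 'b) set" where
  "unital_algebra_hom k A B = {f \<in> algebra_hom k A B. f \<one>\<^bsub>A\<^esub> = \<one>\<^bsub>B\<^esub>}"

definition unital_algebra_mono ::
    "('k, 'r) ring_scheme \<Rightarrow> ('k, 'a) module \<Rightarrow> ('k, 'b) module \<Rightarrow> ('a \<Rightarrow> 'b) set" where
  "unital_algebra_mono k A B = {f \<in> unital_algebra_hom k A B. inj_on f (carrier A)}"

locale algebra_action =
  P: algebra k P + M: nonunital_algebra k M
  for k :: "('k, 'r) ring_scheme" and P :: "('k, 'p) module" and M :: "('k, 'm) module" +
  fixes act :: "'p \<Rightarrow> 'm \<Rightarrow> 'm"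
  assumes act_closed:
      "\<lbrakk>p \<in> carrier P; m \<in> carrier M\<rbrakk> \<Longrightarrow> act p m \<in> carrier M"
    and act_add_left:
      "\<lbrakk>p \<in> carrier P; p' \<in> carrier P; m \<in> carrier M\<rbrakk> \<Longrightarrow>
        act (p \<oplus>\<^bsub>P\<^esub> p') m = act p m \<oplus>\<^bsub>M\<^esub> act p' m"
    and act_add_right:
      "\<lbrakk>p \<in> carrier P; m \<in> carrier M; m' \<in> carrier M\<rbrakk> \<Longrightarrow>
        act p (m \<oplus>\<^bsub>M\<^esub> m') = act p m \<oplus>\<^bsub>M\<^esub> act p m'"
    and act_smult_left:
      "\<lbrakk>a \<in> carrier k; p \<in> carrier P; m \<in> carrier M\<rbrakk> \<Longrightarrow>
        act (a \<odot>\<^bsub>P\<^esub> p) m = a \<odot>\<^bsub>M\<^esub> act p m"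
    and act_smult_right:
      "\<lbrakk>a \<in> carrier k; p \<in> carrier P; m \<in> carrier M\<rbrakk> \<Longrightarrow>
        act p (a \<odot>\<^bsub>M\<^esub> m) = a \<odot>\<^bsub>M\<^esub> act p m"
    and act_mult:
      "\<lbrakk>p \<in> carrier P; m \<in> carrier M; m' \<in> carrier M\<rbrakk> \<Longrightarrow>
        act p (m \<otimes>\<^bsub>M\<^esub> m') = act p m \<otimes>\<^bsub>M\<^esub> m'"
    and act_assoc:
      "\<lbrakk>p \<in> carrier P; p' \<in> carrier P; m \<in> carrier M\<rbrakk> \<Longrightarrow>
        act (p \<otimes>\<^bsub>P\<^esub> p') m = act p (act p' m)"
    and act_one:
      "m \<in> carrier M \<Longrightarrow> act \<one>\<^bsub>P\<^esub> m = m"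

locale two_crossed_module =
  fixes k :: "('k, 'r) ring_scheme"
    and L :: "('k, 'l) module" and M :: "('k, 'm) module" and P :: "('k, 'p) module"
    and bd2 :: "'l \<Rightarrow> 'm" and bd1 :: "'m \<Rightarrow> 'p"
    and actL :: "'p \<Rightarrow> 'l \<Rightarrow> 'l" and actM :: "'p \<Rightarrow> 'm \<Rightarrow> 'm"
    and lifting :: "'m \<Rightarrow> 'm \<Rightarrow> 'l"
  assumes action_L: "algebra_action k P L actL"
    and action_M: "algebra_action k P M actM"
    and bd2_hom: "bd2 \<in> algebra_hom k L M"
    and bd1_hom: "bd1 \<in> algebra_hom k M P"
    and bd_bd: "l \<in> carrier L \<Longrightarrow> bd1 (bd2 l) = \<zero>\<^bsub>P\<^esub>"
    and bd2_equivariant: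
      "\<lbrakk>p \<in> carrier P; l \<in> carrier L\<rbrakk> \<Longrightarrow> bd2 (actL p l) = actM p (bd2 l)"
    and bd1_equivariant:
      "\<lbrakk>p \<in> carrier P; m \<in> carrier M\<rbrakk> \<Longrightarrow> bd1 (actM p m) = p \<otimes>\<^bsub>P\<^esub> bd1 m"
    and lift_closed:
      "\<lbrakk>m \<in> carrier M; m' \<in> carrier M\<rbrakk> \<Longrightarrow> lifting m m' \<in> carrier L"
    \<comment> \<open>\<open>P\<close>-bilinearity is biadditivity together with \<open>PL5\<close>\<close>
    and lift_add_left:
      "\<lbrakk>m0 \<in> carrier M; m1 \<in> carrier M; m2 \<in> carrier M\<rbrakk> \<Longrightarrow>
        lifting (m0 \<oplus>\<^bsub>M\<^esub> m1) m2 = lifting m0 m2 \<oplus>\<^bsub>L\<^esub> lifting m1 m2"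
    and lift_add_right:
      "\<lbrakk>m0 \<in> carrier M; m1 \<in> carrier M; m2 \<in> carrier M\<rbrakk> \<Longrightarrow>
        lifting m0 (m1 \<oplus>\<^bsub>M\<^esub> m2) = lifting m0 m1 \<oplus>\<^bsub>L\<^esub> lifting m0 m2"
    and PL1:
      "\<lbrakk>m0 \<in> carrier M; m1 \<in> carrier M\<rbrakk> \<Longrightarrow>
        bd2 (lifting m0 m1) = m0 \<otimes>\<^bsub>M\<^esub> m1 \<ominus>\<^bsub>M\<^esub> actM (bd1 m1) m0"
    and PL2:
      "\<lbrakk>l0 \<in> carrier L; l1 \<in> carrier L\<rbrakk> \<Longrightarrow>
        lifting (bd2 l0) (bd2 l1) = l0 \<otimes>\<^bsub>L\<^esub> l1"
    and PL3:
      "\<lbrakk>m0 \<in> carrier M; m1 \<in> carrier M; m2 \<in> carrier M\<rbrakk> \<Longrightarrow>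
        lifting m0 (m1 \<otimes>\<^bsub>M\<^esub> m2) =
          lifting (m0 \<otimes>\<^bsub>M\<^esub> m1) m2 \<oplus>\<^bsub>L\<^esub> actL (bd1 m2) (lifting m0 m1)"
    and PL4:
      "\<lbrakk>m \<in> carrier M; l \<in> carrier L\<rbrakk> \<Longrightarrow>
        lifting m (bd2 l) \<ominus>\<^bsub>L\<^esub> lifting (bd2 l) m = actL (bd1 m) l"
    and PL5:
      "\<lbrakk>m0 \<in> carrier M; m1 \<in> carrier M; p \<in> carrier P\<rbrakk> \<Longrightarrow>
        actL p (lifting m0 m1) = lifting (actM p m0) m1 \<and>
        actL p (lifting m0 m1) = lifting m0 (actM p m1)"

text \<open>
  Data of a 2-crossed module: the algebras in degrees 2, 1, 0, the boundary maps out of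
  degrees 2 and 1, the actions of the base algebra on the algebras in degrees 2 and 1,
  and the Peiffer lifting. All maps matter on the carriers only. The base algebra always acts on itself by multiplication.
\<close>

record ('k, 'l, 'm, 'p) two_xmod =
  alg2 :: "('k, 'l) module"
  alg1 :: "('k, 'm) module"
  alg0 :: "('k, 'p) module"
  bd2 :: "'l \<Rightarrow> 'm"
  bd1 :: "'m \<Rightarrow> 'p"
  act2 :: "'p \<Rightarrow> 'l \<Rightarrow> 'l"
  act1 :: "'p \<Rightarrow> 'm \<Rightarrow> 'm"
  peiffer :: "'m \<Rightarrow> 'm \<Rightarrow> 'l"

definition is_two_xmod ::
    "('k, 'r) ring_scheme \<Rightarrow> ('k, 'l, 'm, 'p) two_xmod \<Rightarrow> bool" where
  "is_two_xmod k X \<longleftrightarrow>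
     two_crossed_module k (alg2 X) (alg1 X) (alg0 X) (bd2 X) (bd1 X) (act2 X) (act1 X) (peiffer X)"

definition two_xmod_morphism ::
    "('k, 'r) ring_scheme \<Rightarrow> ('k, 'l, 'm, 'p) two_xmod \<Rightarrow> ('k, 'l', 'm', 'p') two_xmod \<Rightarrow>
     ('l \<Rightarrow> 'l') \<Rightarrow> ('m \<Rightarrow> 'm') \<Rightarrow> ('p \<Rightarrow> 'p') \<Rightarrow> bool" where
  "two_xmod_morphism k X Y f2 f1 f0 \<longleftrightarrow>
     is_two_xmod k X \<and> is_two_xmod k Y \<and>
     f2 \<in> algebra_hom k (alg2 X) (alg2 Y) \<and>
     f1 \<in> algebra_hom k (alg1 X) (alg1 Y) \<and>
     f0 \<in> unital_algebra_hom k (alg0 X) (alg0 Y) \<and>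
     (\<forall>m\<in>carrier (alg1 X). f0 (bd1 X m) = bd1 Y (f1 m)) \<and>
     (\<forall>l\<in>carrier (alg2 X). f1 (bd2 X l) = bd2 Y (f2 l)) \<and>
     (\<forall>p\<in>carrier (alg0 X). \<forall>m\<in>carrier (alg1 X). f1 (act1 X p m) = act1 Y (f0 p) (f1 m)) \<and>
     (\<forall>p\<in>carrier (alg0 X). \<forall>l\<in>carrier (alg2 X). f2 (act2 X p l) = act2 Y (f0 p) (f2 l)) \<and>
     (\<forall>m\<in>carrier (alg1 X). \<forall>m'\<in>carrier (alg1 X).
        peiffer Y (f1 m) (f1 m') = f2 (peiffer X m m'))"

text \<open>
  \<open>(g2, g1, id)\<close> is a morphism from \<open>B\<close> to \<open>Y\<close> whose composite with \<open>(id, fst, \<phi>)\<close> is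
  \<open>(f2, f1, \<phi>)\<close>. Equality of morphisms means agreement on the carriers.
\<close>

definition factors_through ::
    "('k, 'r) ring_scheme \<Rightarrow> ('s \<Rightarrow> 'p) \<Rightarrow> ('k, 'l, 'm \<times> 's, 's) two_xmod \<Rightarrow>
     ('k, 'b2, 'b1, 's) two_xmod \<Rightarrow> ('b2 \<Rightarrow> 'l) \<Rightarrow> ('b1 \<Rightarrow> 'm) \<Rightarrow>
     ('b2 \<Rightarrow> 'l) \<Rightarrow> ('b1 \<Rightarrow> 'm \<times> 's) \<Rightarrow> bool" where
  "factors_through k \<phi> Y B f2 f1 g2 g1 \<longleftrightarrow>
     two_xmod_morphism k B Y g2 g1 id \<and>
     (\<forall>b\<in>carrier (alg2 B). (id \<circ> g2) b = f2 b) \<and>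
     (\<forall>b\<in>carrier (alg1 B). (fst \<circ> g1) b = f1 b) \<and>
     (\<forall>s\<in>carrier (alg0 B). (\<phi> \<circ> id) s = \<phi> s)"

text \<open>
  \<open>Y\<close> is a pullback of \<open>X\<close> along \<open>\<phi> : S \<rightarrow> R\<close>, where \<open>R\<close> is the base algebra of \<open>X\<close>. A formula cannot
  quantify over types, so the element types \<open>'b2\<close> and \<open>'b1\<close> of the test objects \<open>B\<close> are
  parameters; a theorem in which they are type variables covers all test objects.
\<close>

definition is_pullback ::
    "'b2 itself \<Rightarrow> 'b1 itself \<Rightarrow> ('k, 'r) ring_scheme \<Rightarrow> ('k, 'l, 'm, 'p) two_xmod \<Rightarrow>
     ('k, 's) module \<Rightarrow> ('s \<Rightarrow> 'p) \<Rightarrow> ('k, 'l, 'm \<times> 's, 's) two_xmod \<Rightarrow> bool" where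
  "is_pullback _ _ k X S \<phi> Y \<longleftrightarrow>
     is_two_xmod k Y \<and> alg2 Y = alg2 X \<and> alg0 Y = S \<and>
     two_xmod_morphism k Y X id fst \<phi> \<and>
     (\<forall>(B :: ('k, 'b2, 'b1, 's) two_xmod) f2 f1.
        alg0 B = S \<longrightarrow> two_xmod_morphism k B X f2 f1 \<phi> \<longrightarrow>
        (\<exists>g2 g1. factors_through k \<phi> Y B f2 f1 g2 g1 \<and>
           (\<forall>h2 h1. factors_through k \<phi> Y B f2 f1 h2 h1 \<longrightarrow>
              (\<forall>b\<in>carrier (alg2 B). h2 b = g2 b) \<and>
              (\<forall>b\<in>carrier (alg1 B). h1 b = g1 b))))"

definition fibre_product ::
    "('k, 'l, 'm, 'p) two_xmod \<Rightarrow> ('k, 's) module \<Rightarrow> ('s \<Rightarrow> 'p) \<Rightarrow> ('k, 'm \<times> 's) module" where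
  "fibre_product X S \<phi> =
     \<lparr>carrier = {(c, s). c \<in> carrier (alg1 X) \<and> s \<in> carrier S \<and> bd1 X c = \<phi> s},
      mult = (\<lambda>(c, s) (c', s'). (c \<otimes>\<^bsub>alg1 X\<^esub> c', s \<otimes>\<^bsub>S\<^esub> s')),
      one = undefined,
      zero = (\<zero>\<^bsub>alg1 X\<^esub>, \<zero>\<^bsub>S\<^esub>),
      add = (\<lambda>(c, s) (c', s'). (c \<oplus>\<^bsub>alg1 X\<^esub> c', s \<oplus>\<^bsub>S\<^esub> s')),
      smult = (\<lambda>a (c, s). (a \<odot>\<^bsub>alg1 X\<^esub> c, a \<odot>\<^bsub>S\<^esub> s))\<rparr>"

definition pullback_two_xmod ::
    "('k, 'l, 'm, 'p) two_xmod \<Rightarrow> ('k, 's) module \<Rightarrow> ('s \<Rightarrow> 'p) \<Rightarrow>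
     ('k, 'l, 'm \<times> 's, 's) two_xmod" where
  "pullback_two_xmod X S \<phi> =
     \<lparr>alg2 = alg2 X,
      alg1 = fibre_product X S \<phi>,
      alg0 = S,
      bd2 = (\<lambda>c2. (bd2 X c2, \<zero>\<^bsub>S\<^esub>)),
      bd1 = (\<lambda>(c1, s). s),
      act2 = (\<lambda>s c2. act2 X (\<phi> s) c2),
      act1 = (\<lambda>s (c1, s'). (act1 X (\<phi> s) c1, s \<otimes>\<^bsub>S\<^esub> s')),
      peiffer = (\<lambda>(c1, s) (c1', s'). peiffer X c1 c1')\<rparr>"

end

theory Submission
  imports Defs
begin

text \<open>First coordinates inherit their laws from \<open>X\<close>; second coordinates only need
  ring arithmetic in \<open>S\<close>. The fibre product is closed under the componentwise
  operations because \<open>bd1 X\<close> and \<open>\<phi>\<close> are homomorphisms, and under the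
  action of \<open>S\<close> because \<open>bd1 X\<close> is equivariant. In a Peiffer axiom the
  boundary of \<open>(c, s)\<close> acts through \<open>\<phi> s\<close>, which on the fibre product
  equals \<open>bd1 X c\<close>, so the axiom turns into the one for \<open>X\<close>
  (\<open>is_two_xmod_pullback\<close>).

  For the universal property, a morphism \<open>(f2, f1, \<phi>)\<close> from \<open>B\<close> can
  factor in one way only: the projection forces \<open>f2\<close> and the first coordinate
  \<open>f1 b\<close>, while commutation with the boundary to \<open>S\<close> forces the second
  coordinate \<open>bd1 B b\<close> (\<open>factors_through_unique\<close>). This pair does lie in
  the fibre product, since \<open>\<phi> (bd1 B b) = bd1 X (f1 b)\<close> is part of being a
  morphism (\<open>factors_through_pullback\<close>).\<close>

lemma algebra_hom_closed:
  "\<lbrakk>f \<in> algebra_hom k A B; x \<in> carrier A\<rbrakk> \<Longrightarrow> f x \<in> carrier B"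
  by (auto simp: algebra_hom_def)

lemma algebra_hom_add:
  "\<lbrakk>f \<in> algebra_hom k A B; x \<in> carrier A; y \<in> carrier A\<rbrakk> \<Longrightarrow> f (x \<oplus>\<^bsub>A\<^esub> y) = f x \<oplus>\<^bsub>B\<^esub> f y"
  by (auto simp: algebra_hom_def)

lemma algebra_hom_mult:
  "\<lbrakk>f \<in> algebra_hom k A B; x \<in> carrier A; y \<in> carrier A\<rbrakk> \<Longrightarrow> f (x \<otimes>\<^bsub>A\<^esub> y) = f x \<otimes>\<^bsub>B\<^esub> f y"
  by (auto simp: algebra_hom_def)

lemma algebra_hom_smult:
  "\<lbrakk>f \<in> algebra_hom k A B; a \<in> carrier k; x \<in> carrier A\<rbrakk> \<Longrightarrow> f (a \<odot>\<^bsub>A\<^esub> x) = a \<odot>\<^bsub>B\<^esub> f x"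
  by (auto simp: algebra_hom_def)

lemmas algebra_hom_simps =
  algebra_hom_closed algebra_hom_add algebra_hom_mult algebra_hom_smult

text \<open>Linearity over \<open>k\<close> suffices, since zero is the zero scalar times
  itself.\<close>

lemma algebra_hom_zero:
  assumes "f \<in> algebra_hom k A B" "module k A" "module k B"
  shows "f \<zero>\<^bsub>A\<^esub> = \<zero>\<^bsub>B\<^esub>"
proof -
  interpret A: module k A by fact
  interpret B: module k B by fact
  have "f \<zero>\<^bsub>A\<^esub> = f (\<zero>\<^bsub>k\<^esub> \<odot>\<^bsub>A\<^esub> \<zero>\<^bsub>A\<^esub>)" by simp
  also have "\<dots> = \<zero>\<^bsub>k\<^esub> \<odot>\<^bsub>B\<^esub> f \<zero>\<^bsub>A\<^esub>" by (intro algebra_hom_smult[OF assms(1)]) simp_all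
  also have "\<dots> = \<zero>\<^bsub>B\<^esub>" by (simp add: algebra_hom_closed[OF assms(1)])
  finally show ?thesis .
qed

lemma algebra_hom_a_inv:
  assumes "f \<in> algebra_hom k A B" "module k A" "module k B" "x \<in> carrier A"
  shows "f (\<ominus>\<^bsub>A\<^esub> x) = \<ominus>\<^bsub>B\<^esub> f x"
proof -
  interpret A: module k A by fact
  interpret B: module k B by fact
  have "f (\<ominus>\<^bsub>A\<^esub> x) \<oplus>\<^bsub>B\<^esub> f x = f (\<ominus>\<^bsub>A\<^esub> x \<oplus>\<^bsub>A\<^esub> x)"
    using assms(4) by (simp add: algebra_hom_add[OF assms(1)])
  also have "\<dots> = \<zero>\<^bsub>B\<^esub>"
    using assms(4) algebra_hom_zero[OF assms(1-3)] by (simp add: A.l_neg)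
  finally show ?thesis
    using assms(4) by (simp add: B.minus_equality algebra_hom_closed[OF assms(1)])
qed

lemma two_xmod_morphismD:
  assumes "two_xmod_morphism k X Y f2 f1 f0"
  shows "is_two_xmod k X" "is_two_xmod k Y"
    "f2 \<in> algebra_hom k (alg2 X) (alg2 Y)"
    "f1 \<in> algebra_hom k (alg1 X) (alg1 Y)"
    "f0 \<in> unital_algebra_hom k (alg0 X) (alg0 Y)"
    "m \<in> carrier (alg1 X) \<Longrightarrow> f0 (bd1 X m) = bd1 Y (f1 m)"
    "l \<in> carrier (alg2 X) \<Longrightarrow> f1 (bd2 X l) = bd2 Y (f2 l)"
    "\<lbrakk>p \<in> carrier (alg0 X); m \<in> carrier (alg1 X)\<rbrakk> \<Longrightarrow> f1 (act1 X p m) = act1 Y (f0 p) (f1 m)"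
    "\<lbrakk>p \<in> carrier (alg0 X); l \<in> carrier (alg2 X)\<rbrakk> \<Longrightarrow> f2 (act2 X p l) = act2 Y (f0 p) (f2 l)"
    "\<lbrakk>m \<in> carrier (alg1 X); m' \<in> carrier (alg1 X)\<rbrakk> \<Longrightarrow>
       peiffer Y (f1 m) (f1 m') = f2 (peiffer X m m')"
  using assms by (simp_all add: two_xmod_morphism_def)

locale two_xmod_base_change =
  fixes k :: "('k, 'r) ring_scheme"
    and X :: "('k, 'c2, 'c1, 'p) two_xmod"
    and S :: "('k, 's) module"
    and \<phi> :: "'s \<Rightarrow> 'p"
  assumes is_two_xmod: "is_two_xmod k X"
    and algebra_S: "algebra k S"
    and phi: "\<phi> \<in> unital_algebra_hom k S (alg0 X)"
begin

sublocale X: two_crossed_module k "alg2 X" "alg1 X" "alg0 X" "bd2 X" "bd1 X" "act2 X" "act1 X"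
    "peiffer X"
  using is_two_xmod by (simp add: is_two_xmod_def)

sublocale S: algebra k S
  by (rule algebra_S)

sublocale A2: algebra_action k "alg0 X" "alg2 X" "act2 X"
  by (rule X.action_L)

sublocale A1: algebra_action k "alg0 X" "alg1 X" "act1 X"
  by (rule X.action_M)

lemma phi_hom: "\<phi> \<in> algebra_hom k S (alg0 X)"
  and phi_one: "\<phi> \<one>\<^bsub>S\<^esub> = \<one>\<^bsub>alg0 X\<^esub>"
  using phi by (simp_all add: unital_algebra_hom_def)

lemmas phi_simps = algebra_hom_simps[OF phi_hom] phi_one
  algebra_hom_zero[OF phi_hom S.module_axioms A2.P.module_axioms]
  algebra_hom_a_inv[OF phi_hom S.module_axioms A2.P.module_axioms]

lemmas bd1_simps = algebra_hom_simps[OF X.bd1_hom]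
  algebra_hom_zero[OF X.bd1_hom A1.M.module_axioms A2.P.module_axioms]
  algebra_hom_a_inv[OF X.bd1_hom A1.M.module_axioms A2.P.module_axioms]

section \<open>The fibre product as an algebra\<close>

abbreviation "F \<equiv> fibre_product X S \<phi>"

lemma carrier_fibre [simp]:
  "(c, s) \<in> carrier F \<longleftrightarrow> c \<in> carrier (alg1 X) \<and> s \<in> carrier S \<and> bd1 X c = \<phi> s"
  by (simp add: fibre_product_def)

lemma fibre_simps [simp]:
  "(c, s) \<otimes>\<^bsub>F\<^esub> (c', s') = (c \<otimes>\<^bsub>alg1 X\<^esub> c', s \<otimes>\<^bsub>S\<^esub> s')"
  "(c, s) \<oplus>\<^bsub>F\<^esub> (c', s') = (c \<oplus>\<^bsub>alg1 X\<^esub> c', s \<oplus>\<^bsub>S\<^esub> s')"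
  "\<zero>\<^bsub>F\<^esub> = (\<zero>\<^bsub>alg1 X\<^esub>, \<zero>\<^bsub>S\<^esub>)"
  "a \<odot>\<^bsub>F\<^esub> (c, s) = (a \<odot>\<^bsub>alg1 X\<^esub> c, a \<odot>\<^bsub>S\<^esub> s)"
  by (simp_all add: fibre_product_def)

lemma abelian_group_fibre: "abelian_group F"
proof (rule abelian_groupI)
  fix x assume "x \<in> carrier F"
  then obtain c s where x: "x = (c, s)" "c \<in> carrier (alg1 X)" "s \<in> carrier S" "bd1 X c = \<phi> s"
    by (cases x) auto
  show "\<exists>y\<in>carrier F. y \<oplus>\<^bsub>F\<^esub> x = \<zero>\<^bsub>F\<^esub>"
    using x by (intro bexI[of _ "(\<ominus>\<^bsub>alg1 X\<^esub> c, \<ominus>\<^bsub>S\<^esub> s)"])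
      (auto simp: phi_simps bd1_simps A1.M.l_neg S.l_neg)
qed (auto simp: phi_simps bd1_simps A1.M.a_assoc S.a_assoc
    intro: A1.M.a_comm S.a_comm)

lemma nonunital_algebra_fibre: "nonunital_algebra k F"
proof (intro nonunital_algebra.intro nonunital_algebra_axioms.intro moduleI abelian_group_fibre)
  show "cring k" by (rule S.R_cring)
qed (auto simp: phi_simps bd1_simps A1.M.smult_l_distr S.smult_l_distr A1.M.smult_r_distr
    S.smult_r_distr A1.M.smult_assoc1 S.smult_assoc1 A1.M.mult_closed A1.M.mult_assoc
    S.m_assoc A1.M.distr S.l_distr A1.M.smult_mult S.smult_assoc2
    intro: A1.M.mult_comm S.m_comm)

sublocale F: nonunital_algebra k F
  by (rule nonunital_algebra_fibre)

text \<open>Negation in \<open>F\<close> is not a component of the record but is determined by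
  addition; the componentwise negative is an inverse inside \<open>F\<close>, hence the inverse.
  Serves the subtraction in PL1.\<close>

lemma fibre_minus:
  assumes "(c, s) \<in> carrier F" "(c', s') \<in> carrier F"
  shows "(c, s) \<ominus>\<^bsub>F\<^esub> (c', s') = (c \<ominus>\<^bsub>alg1 X\<^esub> c', s \<ominus>\<^bsub>S\<^esub> s')"
proof -
  have "\<ominus>\<^bsub>F\<^esub> (c', s') = (\<ominus>\<^bsub>alg1 X\<^esub> c', \<ominus>\<^bsub>S\<^esub> s')"
    using assms(2)
    by (intro F.minus_equality) (auto simp: phi_simps bd1_simps A1.M.l_neg S.l_neg)
  then show ?thesis
    by (simp add: a_minus_def)
qed

lemma fst_hom: "fst \<in> algebra_hom k F (alg1 X)"
  by (auto simp: algebra_hom_def)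

section \<open>The 2-crossed module structure over S\<close>

abbreviation "Y \<equiv> pullback_two_xmod X S \<phi>"

lemma pullback_simps [simp]:
  "alg2 Y = alg2 X" "alg1 Y = F" "alg0 Y = S"
  "bd2 Y l = (bd2 X l, \<zero>\<^bsub>S\<^esub>)" "bd1 Y (c, s) = s"
  "act2 Y t l = act2 X (\<phi> t) l" "act1 Y t (c, s) = (act1 X (\<phi> t) c, t \<otimes>\<^bsub>S\<^esub> s)"
  "peiffer Y (c, s) (c', s') = peiffer X c c'"
  by (simp_all add: pullback_two_xmod_def)

text \<open>Restriction of the action along the unital homomorphism \<open>\<phi>\<close>.\<close>

lemma algebra_action_alg2: "algebra_action k S (alg2 X) (act2 Y)"
  by (intro algebra_action.intro algebra_action_axioms.intro S.algebra_axioms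
      A2.M.nonunital_algebra_axioms)
    (auto simp: phi_simps A2.act_closed A2.act_add_left A2.act_add_right A2.act_smult_left
      A2.act_smult_right A2.act_mult A2.act_assoc A2.act_one)

text \<open>The action stays in \<open>F\<close> because \<open>bd1 X\<close> sends
  \<open>\<phi> t\<close> acting on \<open>c\<close> to the product of \<open>\<phi> t\<close> and
  \<open>bd1 X c = \<phi> s\<close>, which is \<open>\<phi>\<close> of the product of
  \<open>t\<close> and \<open>s\<close>.\<close>

lemma algebra_action_fibre: "algebra_action k S F (act1 Y)"
proof (intro algebra_action.intro algebra_action_axioms.intro S.algebra_axioms
    F.nonunital_algebra_axioms)
  fix a t m assume "a \<in> carrier k" "t \<in> carrier S" "m \<in> carrier F"
  \<comment> \<open>In \<open>S\<close> the scalar sits on the second factor, but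
    \<open>S.smult_assoc2\<close> extracts it from the first, so the factors have to be
    commuted.\<close>
  then show "act1 Y t (a \<odot>\<^bsub>F\<^esub> m) = a \<odot>\<^bsub>F\<^esub> act1 Y t m"
    using S.smult_assoc2[of a _ t] by (cases m) (auto simp: phi_simps A1.act_smult_right S.m_comm)
qed (auto simp: phi_simps bd1_simps A1.act_closed X.bd1_equivariant A1.act_add_left
    A1.act_add_right A1.act_smult_left A1.act_mult A1.act_assoc A1.act_one
    S.l_distr S.r_distr S.smult_assoc2 S.m_assoc)

lemma is_two_xmod_pullback: "is_two_xmod k Y"
  unfolding is_two_xmod_def
proof (rule two_crossed_module.intro)
  show "algebra_action k (alg0 Y) (alg2 Y) (act2 Y)"
    using algebra_action_alg2 by simp
  show "algebra_action k (alg0 Y) (alg1 Y) (act1 Y)"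
    using algebra_action_fibre by simp
  \<comment> \<open>The values lie in \<open>F\<close> because \<open>bd1 X\<close> kills boundaries
    and \<open>\<phi>\<close> maps zero to zero.\<close>
  show "bd2 Y \<in> algebra_hom k (alg2 Y) (alg1 Y)"
    using X.bd2_hom by (auto simp: algebra_hom_def phi_simps X.bd_bd)
  show "bd1 Y \<in> algebra_hom k (alg1 Y) (alg0 Y)"
    by (auto simp: algebra_hom_def)
next
  fix m0 m1 assume "m0 \<in> carrier (alg1 Y)" "m1 \<in> carrier (alg1 Y)"
  then obtain c s c' s' where [simp]: "m0 = (c, s)" "m1 = (c', s')"
    and m: "(c, s) \<in> carrier F" "(c', s') \<in> carrier F"
    by (cases m0, cases m1) auto
  \<comment> \<open>Both terms of the difference must be in \<open>F\<close> for
    \<open>fibre_minus\<close>; the component rules are switched off so that the closure rules for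
    \<open>F\<close> still match.\<close>
  have "act1 Y s' (c, s) \<in> carrier F" "(c, s) \<otimes>\<^bsub>F\<^esub> (c', s') \<in> carrier F"
    using m by (auto intro!: algebra_action.act_closed[OF algebra_action_fibre] F.mult_closed
        simp del: fibre_simps pullback_simps)
  then have "(c, s) \<otimes>\<^bsub>F\<^esub> (c', s') \<ominus>\<^bsub>F\<^esub> act1 Y s' (c, s)
      = (c \<otimes>\<^bsub>alg1 X\<^esub> c' \<ominus>\<^bsub>alg1 X\<^esub> act1 X (\<phi> s') c, s \<otimes>\<^bsub>S\<^esub> s' \<ominus>\<^bsub>S\<^esub> s' \<otimes>\<^bsub>S\<^esub> s)"
    using fibre_minus by simp
  \<comment> \<open>The first coordinate is PL1 of \<open>X\<close> because
    \<open>bd1 X c' = \<phi> s'\<close>; the second vanishes by commutativity of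
    \<open>S\<close>.\<close>
  with m show "bd2 Y (peiffer Y m0 m1) = m0 \<otimes>\<^bsub>alg1 Y\<^esub> m1 \<ominus>\<^bsub>alg1 Y\<^esub> act1 Y (bd1 Y m1) m0"
    by (simp add: X.PL1 a_minus_def S.m_comm[of s' s] S.r_neg)
next
  fix m0 m1 p assume "m0 \<in> carrier (alg1 Y)" "m1 \<in> carrier (alg1 Y)" "p \<in> carrier (alg0 Y)"
  \<comment> \<open>Read from right to left, both equations of PL5 pull the action out of the
    lifting, so all sides reach one normal form.\<close>
  then show "act2 Y p (peiffer Y m0 m1) = peiffer Y (act1 Y p m0) m1 \<and>
      act2 Y p (peiffer Y m0 m1) = peiffer Y m0 (act1 Y p m1)"
    by (cases m0, cases m1) (simp add: phi_simps flip: X.PL5)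
next
  fix m l assume "m \<in> carrier (alg1 Y)" "l \<in> carrier (alg2 Y)"
  then show "peiffer Y m (bd2 Y l) \<ominus>\<^bsub>alg2 Y\<^esub> peiffer Y (bd2 Y l) m = act2 Y (bd1 Y m) l"
    by (cases m) (simp add: X.PL4)
qed (auto simp: phi_simps X.bd2_equivariant X.lift_closed X.lift_add_left X.lift_add_right
    X.PL2 X.PL3)

section \<open>The universal property\<close>

lemma projection_morphism: "two_xmod_morphism k Y X id fst \<phi>"
  using is_two_xmod is_two_xmod_pullback phi fst_hom
  by (auto simp: two_xmod_morphism_def algebra_hom_def)

lemma factors_through_pullback:
  assumes B: "alg0 B = S" and f: "two_xmod_morphism k B X f2 f1 \<phi>"
  shows "factors_through k \<phi> Y B f2 f1 f2 (\<lambda>b. (f1 b, bd1 B b))"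
proof -
  note f = two_xmod_morphismD[OF f]
  interpret B: two_crossed_module k "alg2 B" "alg1 B" S "bd2 B" "bd1 B" "act2 B" "act1 B"
    "peiffer B"
    using f(1) by (simp add: is_two_xmod_def B)
  have "(\<lambda>b. (f1 b, bd1 B b)) \<in> algebra_hom k (alg1 B) F"
    using f(4) B.bd1_hom by (auto simp: algebra_hom_def f(6))
  moreover have "id \<in> unital_algebra_hom k S S"
    by (auto simp: unital_algebra_hom_def algebra_hom_def)
  \<comment> \<open>On second coordinates, compatibility with \<open>bd2\<close> amounts to
    \<open>B.bd_bd\<close>, and compatibility with the action to equivariance of
    \<open>bd1 B\<close>; the first coordinates repeat the laws of \<open>f1\<close> and
    \<open>f2\<close>.\<close>
  ultimately show ?thesis
    using f(1,3,7-10) is_two_xmod_pullback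
    by (auto simp: factors_through_def two_xmod_morphism_def B B.bd_bd B.bd1_equivariant)
qed

text \<open>
  Commutation with \<^const>\<open>bd1\<close> forces the \<open>S\<close>-component of the middle map.
\<close>

lemma factors_through_unique:
  assumes "factors_through k \<phi> Y B f2 f1 h2 h1"
  shows "a \<in> carrier (alg2 B) \<Longrightarrow> h2 a = f2 a"
    and "b \<in> carrier (alg1 B) \<Longrightarrow> h1 b = (f1 b, bd1 B b)"
proof -
  have h: "two_xmod_morphism k B Y h2 h1 id"
    using assms by (simp add: factors_through_def)
  show "a \<in> carrier (alg2 B) \<Longrightarrow> h2 a = f2 a"
    using assms by (simp add: factors_through_def)
  assume b: "b \<in> carrier (alg1 B)"
  then have "fst (h1 b) = f1 b"
    using assms by (simp add: factors_through_def)
  moreover have "snd (h1 b) = bd1 B b"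
    using two_xmod_morphismD(6)[OF h b] by (cases "h1 b") simp
  ultimately show "h1 b = (f1 b, bd1 B b)"
    by (simp add: prod_eq_iff)
qed

lemma is_pullback: "is_pullback TYPE('b2) TYPE('b1) k X S \<phi> Y"
proof -
  have "\<exists>g2 g1. factors_through k \<phi> Y B f2 f1 g2 g1 \<and>
      (\<forall>h2 h1. factors_through k \<phi> Y B f2 f1 h2 h1 \<longrightarrow>
        (\<forall>b\<in>carrier (alg2 B). h2 b = g2 b) \<and> (\<forall>b\<in>carrier (alg1 B). h1 b = g1 b))"
    if "alg0 B = S" "two_xmod_morphism k B X f2 f1 \<phi>"
    for B :: "('k, 'b2, 'b1, 's) two_xmod" and f2 f1
    using factors_through_pullback[OF that]
    by (intro exI[of _ f2] exI[of _ "\<lambda>b. (f1 b, bd1 B b)"])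
      (blast intro: factors_through_unique)
  then show ?thesis
    by (simp add: is_pullback_def is_two_xmod_pullback projection_morphism)
qed

end

theorem proposition4:
  fixes k :: "('k, 'r) ring_scheme"
    and X :: "('k, 'c2, 'c1, 'p) two_xmod"
    and S :: "('k, 's) module"
    and \<phi> :: "'s \<Rightarrow> 'p"
  assumes "cring k"
    and "is_two_xmod k X"
    and "algebra k S"
    and "\<phi> \<in> unital_algebra_mono k S (alg0 X)"
  shows "is_pullback TYPE('b2) TYPE('b1) k X S \<phi> (pullback_two_xmod X S \<phi>)"
proof -
  interpret two_xmod_base_change k X S \<phi>
    using assms(2-4) by (intro two_xmod_base_change.intro) (simp_all add: unital_algebra_mono_def)
  show ?thesis
    by (rule is_pullback)
qed

end
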